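(* Let $\mathcal{Q}$ be a poset equipped with a superlinear family of translations $T_\bullet$, let $f\colon\mathcal{P}\to\mathcal{Q}$ be any map of posets, and let $\mathbf{C}$ be a cocomplete category. Equip $\mathrm{Fun}(\mathcal{Q},\mathbf{C})$ with the weak interleaving distance $d_{\mathcal{Q}}$ and $\mathrm{Fun}(\mathcal{P},\mathbf{C})$ with the weak relative interleaving distance $d_{\mathcal{P}}=d_f$. Then the pushforward functor $f_*\colon\mathrm{Fun}(\mathcal{P},\mathbf{C})\to\mathrm{Fun}(\mathcal{Q},\mathbf{C})$ induces an isometry onto its image: for all $\mathcal{P}$-modules $M,N$, $$d_{\mathcal{P}}(M,N)=d_{\mathcal{Q}}(f_*M,f_*N).$$
   Context: Posets are viewed as categories; a map of posets is a monotone map. For a poset $\mathcal{P}$ and a category $\mathbf{C}$, a $\mathcal{P}$-module is a functor $\mathcal{P}\to\mathbf{C}$. Pullback and pushforward: for a map of posets $f\colon\mathcal{P}\to\mathcal{Q}$, $f^*M=M\circ f$ for a $\mathcal{Q}$-module $M$, and $f_*M=\mathrm{Lan}_fM$ for a $\mathcal{P}$-module $M$, i.e. $(f_*M)(q)=\varinjlim_{p\,:\,f(p)\le q}M(p)$. The functor $f_*$ is left adjoint to $f^*$, with unit $\upsilon\colon\mathrm{id}\Rightarrow f^*f_*$ and counit $\chi\colon f_*f^*\Rightarrow\mathrm{id}$. Translations: a translation on $\mathcal{Q}$ is a monotone map $T\colon\mathcal{Q}\to\mathcal{Q}$ with $q\le T(q)$ for all $q$. A superlinear family of translations is an assignment $\varepsilon\mapsto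 T_\varepsilon$, $\varepsilon\in[0,\infty)$, of translations with $T_{\varepsilon_2}\circ T_{\varepsilon_1}\le T_{\varepsilon_1+\varepsilon_2}$ pointwise (hence $T_\varepsilon\le T_{\varepsilon'}$ when $\varepsilon\le\varepsilon'$). Weak interleavings over $\mathcal{Q}$: for a $\mathcal{Q}$-module $M$ put $(M)^\varepsilon_{\mathcal{Q}}=T_\varepsilon^*M=M\circ T_\varepsilon$ (functorial in $M$; write $\varphi^\varepsilon=T_\varepsilon^*\varphi$). The internal maps of $M$ give natural maps $\eta^\varepsilon_{\mathcal{Q}}\colon M\to(M)^\varepsilon_{\mathcal{Q}}$, $\eta^{\varepsilon,\varepsilon'}_{\mathcal{Q}}\colon(M)^\varepsilon_{\mathcal{Q}}\to(M)^{\varepsilon'}_{\mathcal{Q}}$ for $\varepsilon\le\varepsilon'$, and $\Sigma^{\varepsilon_1,\varepsilon_2}_{\mathcal{Q}}\colon((M)^{\varepsilon_1}_{\mathcal{Q}})^{\varepsilon_2}_{\mathcal{Q}}\to(M)^{\varepsilon_1+\varepsilon_2}_{\mathcal{Q}}$. A weak $\varepsilon$-interleaving of $M,N$ is a pair $\varphi\colon M\to(N)^\varepsilon_{\mathcal{Q}}$, $\psi\colon N\to(M)^\varepsilon_{\mathcal{Q}}$ with $\Sigma^{\varepsilon,\varepsilon}_{\mathcal{Q}}\circ\psi^\varepsilon\circ\varphi=\eta^{0,2\varepsilon}_{\mathcal{Q}}\circ\eta^0_{\mathcal{Q}}$ on $M$ and $\Sigma^{\varepsilon,\varepsilon}_{\mathcal{Q}}\circ\varphi^\varepsilon\circ\psi=\eta^{0,2\varepsilon}_{\mathcal{Q}}\circ\eta^0_{\mathcal{Q}}$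 on $N$. The weak interleaving distance $d_{\mathcal{Q}}(M,N)$ is the infimum of all $\varepsilon\ge0$ for which a weak $\varepsilon$-interleaving exists ($\infty$ if none). Weak interleavings relative to $f$: for a $\mathcal{P}$-module $M$ put $(M)^\varepsilon_{\mathcal{P}}=f^*T_\varepsilon^*f_*M$ (functorial; $\varphi^\varepsilon=f^*T_\varepsilon^*f_*\varphi$). Let $\eta^\varepsilon_{\mathcal{P}}$ be the composite $M\xrightarrow{\upsilon}f^*f_*M\xrightarrow{f^*\eta^\varepsilon_{\mathcal{Q}}}f^*T_\varepsilon^*f_*M$, let $\eta^{\varepsilon,\varepsilon'}_{\mathcal{P}}=f^*\eta^{\varepsilon,\varepsilon'}_{\mathcal{Q}}f_*$, and let $\Sigma^{\varepsilon_1,\varepsilon_2}_{\mathcal{P}}$ be the composite $$((M)^{\varepsilon_1}_{\mathcal{P}})^{\varepsilon_2}_{\mathcal{P}}=f^*T_{\varepsilon_2}^*f_*f^*T_{\varepsilon_1}^*f_*M\xrightarrow{f^*T_{\varepsilon_2}^*\chi}f^*T_{\varepsilon_2}^*T_{\varepsilon_1}^*f_*M\xrightarrow{f^*\Sigma_{\mathcal{Q}}^{\varepsilon_1,\varepsilon_2}}f^*T_{\varepsilon_1+\varepsilon_2}^*f_*M=(M)^{\varepsilon_1+\varepsilon_2}_{\mathcal{P}}.$$ A weak $\varepsilon$-interleaving relative to $f$ of $\mathcal{P}$-modules $M,N$ is a pair $\varphi\colon M\to(N)^\varepsilon_{\mathcal{P}}$, $\psi\colon N\to(M)^\varepsilon_{\mathcal{P}}$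 with $\Sigma^{\varepsilon,\varepsilon}_{\mathcal{P}}\circ\psi^\varepsilon\circ\varphi=\eta^{0,2\varepsilon}_{\mathcal{P}}\circ\eta^0_{\mathcal{P}}$ on $M$ and symmetrically on $N$. The weak relative interleaving distance $d_f(M,N)=d_{\mathcal{P}}(M,N)$ is the infimum of all $\varepsilon\ge0$ for which such a pair exists ($\infty$ if none). *)

theory Defs
  imports Complex_Main "HOL-Library.Extended_Nonnegative_Real"
begin

section \<open>Categories, functors and colimits\<close>

record ('o, 'a) cat =
  Obj :: "'o set"
  Arr :: "'a set"
  Dom :: "'a \<Rightarrow> 'o"
  Cod :: "'a \<Rightarrow> 'o"
  Ide :: "'o \<Rightarrow> 'a"
  Cmp :: "'a \<Rightarrow> 'a \<Rightarrow> 'a"  (infixr "\<odot>\<index>" 70)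

definition hom :: "('o, 'a) cat \<Rightarrow> 'o \<Rightarrow> 'o \<Rightarrow> 'a set" where
  "hom C x y = {u \<in> Arr C. Dom C u = x \<and> Cod C u = y}"

locale category =
  fixes C :: "('o, 'a) cat"  (structure)
  assumes Dom_Obj: "u \<in> Arr C \<Longrightarrow> Dom C u \<in> Obj C"
    and Cod_Obj: "u \<in> Arr C \<Longrightarrow> Cod C u \<in> Obj C"
    and Ide_hom: "x \<in> Obj C \<Longrightarrow> Ide C x \<in> hom C x x"
    and Cmp_hom: "u \<in> hom C x y \<Longrightarrow> v \<in> hom C y z \<Longrightarrow> v \<odot> u \<in> hom C x z"
    and Cmp_Ide_right: "u \<in> hom C x y \<Longrightarrow> u \<odot> Ide C x = u"
    and Cmp_Ide_left: "u \<in> hom C x y \<Longrightarrow> Ide C y \<odot> u = u"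
    and Cmp_assoc: "u \<in> hom C w x \<Longrightarrow> v \<in> hom C x y \<Longrightarrow> t \<in> hom C y z \<Longrightarrow>
      (t \<odot> v) \<odot> u = t \<odot> (v \<odot> u)"

record ('j, 'i, 'o, 'a) fct =
  omap :: "'j \<Rightarrow> 'o"
  amap :: "'i \<Rightarrow> 'a"

definition is_functor :: "('j, 'i) cat \<Rightarrow> ('o, 'a) cat \<Rightarrow> ('j, 'i, 'o, 'a) fct \<Rightarrow> bool" where
  "is_functor J C F \<longleftrightarrow>
     (\<forall>x \<in> Obj J. omap F x \<in> Obj C) \<and>
     (\<forall>u \<in> Arr J. amap F u \<in> hom C (omap F (Dom J u)) (omap F (Cod J u))) \<and>
     (\<forall>x \<in> Obj J. amap F (Ide J x) = Ide C (omap F x)) \<and>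
     (\<forall>u \<in> Arr J. \<forall>v \<in> Arr J. Cod J u = Dom J v \<longrightarrow>
        amap F (v \<odot>\<^bsub>J\<^esub> u) = amap F v \<odot>\<^bsub>C\<^esub> amap F u)"

definition nat_trans :: "('j, 'i) cat \<Rightarrow> ('o, 'a) cat \<Rightarrow> ('j, 'i, 'o, 'a) fct \<Rightarrow>
    ('j, 'i, 'o, 'a) fct \<Rightarrow> ('j \<Rightarrow> 'a) \<Rightarrow> bool" where
  "nat_trans J C F G \<phi> \<longleftrightarrow>
     (\<forall>x \<in> Obj J. \<phi> x \<in> hom C (omap F x) (omap G x)) \<and>
     (\<forall>u \<in> Arr J. \<phi> (Cod J u) \<odot>\<^bsub>C\<^esub> amap F u = amap G u \<odot>\<^bsub>C\<^esub> \<phi> (Dom J u))"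

definition vcomp :: "('o, 'a) cat \<Rightarrow> ('j \<Rightarrow> 'a) \<Rightarrow> ('j \<Rightarrow> 'a) \<Rightarrow> 'j \<Rightarrow> 'a" where
  "vcomp C \<psi> \<phi> x = \<psi> x \<odot>\<^bsub>C\<^esub> \<phi> x"

definition cocone :: "('j, 'i) cat \<Rightarrow> ('o, 'a) cat \<Rightarrow> ('j, 'i, 'o, 'a) fct \<Rightarrow>
    'o \<Rightarrow> ('j \<Rightarrow> 'a) \<Rightarrow> bool" where
  "cocone J C D c \<iota> \<longleftrightarrow>
     c \<in> Obj C \<and>
     (\<forall>j \<in> Obj J. \<iota> j \<in> hom C (omap D j) c) \<and>
     (\<forall>u \<in> Arr J. \<iota> (Cod J u) \<odot>\<^bsub>C\<^esub> amap D u = \<iota> (Dom J u))"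

definition colimit :: "('j, 'i) cat \<Rightarrow> ('o, 'a) cat \<Rightarrow> ('j, 'i, 'o, 'a) fct \<Rightarrow>
    'o \<Rightarrow> ('j \<Rightarrow> 'a) \<Rightarrow> bool" where
  "colimit J C D c \<iota> \<longleftrightarrow>
     cocone J C D c \<iota> \<and>
     (\<forall>d \<kappa>. cocone J C D d \<kappa> \<longrightarrow>
        (\<exists>!u. u \<in> hom C c d \<and> (\<forall>j \<in> Obj J. u \<odot>\<^bsub>C\<^esub> \<iota> j = \<kappa> j)))"

text \<open>
  HOL cannot quantify over types inside a formula, so ``small'' has to be fixed by the two type
  arguments: the index categories are all those whose objects are drawn from the first type and
  whose arrows are drawn from the second.
\<close>

definition cocomplete :: "'j itself \<Rightarrow> 'i itself \<Rightarrow> ('o, 'a) cat \<Rightarrow> bool" where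
  "cocomplete _ _ C \<longleftrightarrow>
     category C \<and>
     (\<forall>(J :: ('j, 'i) cat) D. category J \<and> is_functor J C D \<longrightarrow> (\<exists>c \<iota>. colimit J C D c \<iota>))"

text \<open>A fixed but arbitrary choice of colimit cocone (apex and legs); unspecified if none exists.\<close>

definition colim_cocone :: "('j, 'i) cat \<Rightarrow> ('o, 'a) cat \<Rightarrow> ('j, 'i, 'o, 'a) fct \<Rightarrow>
    'o \<times> ('j \<Rightarrow> 'a)" where
  "colim_cocone J C D = (SOME (c, \<iota>). colimit J C D c \<iota>)"

definition colim :: "('j, 'i) cat \<Rightarrow> ('o, 'a) cat \<Rightarrow> ('j, 'i, 'o, 'a) fct \<Rightarrow> 'o" where
  "colim J C D = fst (colim_cocone J C D)"

definition leg :: "('j, 'i) cat \<Rightarrow> ('o, 'a) cat \<Rightarrow> ('j, 'i, 'o, 'a) fct \<Rightarrow> 'j \<Rightarrow> 'a" where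
  "leg J C D = snd (colim_cocone J C D)"

text \<open>The arrow from the chosen colimit of \<open>D\<close> to \<open>d\<close> induced by a cocone \<open>\<kappa>\<close> with apex \<open>d\<close>.\<close>

definition desc :: "('j, 'i) cat \<Rightarrow> ('o, 'a) cat \<Rightarrow> ('j, 'i, 'o, 'a) fct \<Rightarrow>
    'o \<Rightarrow> ('j \<Rightarrow> 'a) \<Rightarrow> 'a" where
  "desc J C D d \<kappa> =
     (THE u. u \<in> hom C (colim J C D) d \<and> (\<forall>j \<in> Obj J. u \<odot>\<^bsub>C\<^esub> leg J C D j = \<kappa> j))"


section \<open>Posets and modules\<close>

text \<open>
  A poset is a relation \<open>P\<close> with \<^term>\<open>Partial_order P\<close>; its carrier is \<^term>\<open>Field P\<close> and
  \<open>(x, y) \<in> P\<close> means \<open>x \<le> y\<close>. In the associated category the arrow \<open>x \<rightarrow> y\<close> is the pair \<open>(x, y)\<close>.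
\<close>

definition poset_cat :: "'p rel \<Rightarrow> ('p, 'p \<times> 'p) cat" where
  "poset_cat P = \<lparr>Obj = Field P, Arr = P, Dom = fst, Cod = snd,
     Ide = (\<lambda>x. (x, x)), Cmp = (\<lambda>v u. (fst u, snd v))\<rparr>"

text \<open>Between posets, \<^term>\<open>compat P Q f\<close> also forces \<open>f\<close> to map \<^term>\<open>Field P\<close> into \<^term>\<open>Field Q\<close>.\<close>

definition poset_map :: "'p rel \<Rightarrow> 'q rel \<Rightarrow> ('p \<Rightarrow> 'q) \<Rightarrow> bool" where
  "poset_map P Q f \<longleftrightarrow> Partial_order P \<and> Partial_order Q \<and> compat P Q f"

type_synonym ('p, 'o, 'a) pmod = "('p, 'p \<times> 'p, 'o, 'a) fct"

definition is_pmod :: "'p rel \<Rightarrow> ('o, 'a) cat \<Rightarrow> ('p, 'o, 'a) pmod \<Rightarrow> bool" where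
  "is_pmod P C M \<longleftrightarrow> is_functor (poset_cat P) C M"

definition pmod_hom :: "'p rel \<Rightarrow> ('o, 'a) cat \<Rightarrow> ('p, 'o, 'a) pmod \<Rightarrow> ('p, 'o, 'a) pmod \<Rightarrow>
    ('p \<Rightarrow> 'a) \<Rightarrow> bool" where
  "pmod_hom P C M N \<phi> \<longleftrightarrow> nat_trans (poset_cat P) C M N \<phi>"


section \<open>Pullback and pushforward along a map of posets\<close>

definition pull :: "('p \<Rightarrow> 'q) \<Rightarrow> ('q, 'o, 'a) pmod \<Rightarrow> ('p, 'o, 'a) pmod" where
  "pull f M = \<lparr>omap = (\<lambda>p. omap M (f p)), amap = (\<lambda>(p, p'). amap M (f p, f p'))\<rparr>"

definition pull_nt :: "('p \<Rightarrow> 'q) \<Rightarrow> ('q \<Rightarrow> 'a) \<Rightarrow> 'p \<Rightarrow> 'a" where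
  "pull_nt f \<phi> p = \<phi> (f p)"

definition slice :: "'p rel \<Rightarrow> 'q rel \<Rightarrow> ('p \<Rightarrow> 'q) \<Rightarrow> 'q \<Rightarrow> ('p, 'p \<times> 'p) cat" where
  "slice P Q f q = poset_cat (Restr P {p \<in> Field P. (f p, q) \<in> Q})"

text \<open>
  The functor \<open>f\<^sub>*\<close>, i.e. the pointwise left Kan extension along \<open>f\<close>: on modules, the structure
  map at \<open>q \<le> q'\<close> is induced by the legs of the colimit at \<open>q'\<close>, whose index poset contains the one
  at \<open>q\<close>.
\<close>

definition push :: "'p rel \<Rightarrow> 'q rel \<Rightarrow> ('p \<Rightarrow> 'q) \<Rightarrow> ('o, 'a) cat \<Rightarrow>
    ('p, 'o, 'a) pmod \<Rightarrow> ('q, 'o, 'a) pmod" where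
  "push P Q f C M = \<lparr>
     omap = (\<lambda>q. colim (slice P Q f q) C M),
     amap = (\<lambda>(q, q'). desc (slice P Q f q) C M
               (colim (slice P Q f q') C M) (leg (slice P Q f q') C M))\<rparr>"

definition push_nt :: "'p rel \<Rightarrow> 'q rel \<Rightarrow> ('p \<Rightarrow> 'q) \<Rightarrow> ('o, 'a) cat \<Rightarrow>
    ('p, 'o, 'a) pmod \<Rightarrow> ('p, 'o, 'a) pmod \<Rightarrow> ('p \<Rightarrow> 'a) \<Rightarrow> 'q \<Rightarrow> 'a" where
  "push_nt P Q f C M N \<phi> q = desc (slice P Q f q) C M
     (colim (slice P Q f q) C N) (\<lambda>p. leg (slice P Q f q) C N p \<odot>\<^bsub>C\<^esub> \<phi> p)"

definition adj_unit :: "'p rel \<Rightarrow> 'q rel \<Rightarrow> ('p \<Rightarrow> 'q) \<Rightarrow> ('o, 'a) cat \<Rightarrow>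
    ('p, 'o, 'a) pmod \<Rightarrow> 'p \<Rightarrow> 'a" where
  "adj_unit P Q f C M p = leg (slice P Q f (f p)) C M p"

definition adj_counit :: "'p rel \<Rightarrow> 'q rel \<Rightarrow> ('p \<Rightarrow> 'q) \<Rightarrow> ('o, 'a) cat \<Rightarrow>
    ('q, 'o, 'a) pmod \<Rightarrow> 'q \<Rightarrow> 'a" where
  "adj_counit P Q f C N q =
     desc (slice P Q f q) C (pull f N) (omap N q) (\<lambda>p. amap N (f p, q))"


section \<open>Weak interleavings over a poset with translations\<close>

definition translation :: "'q rel \<Rightarrow> ('q \<Rightarrow> 'q) \<Rightarrow> bool" where
  "translation Q t \<longleftrightarrow> poset_map Q Q t \<and> (\<forall>q \<in> Field Q. (q, t q) \<in> Q)"

definition superlinear_family :: "'q rel \<Rightarrow> (real \<Rightarrow> 'q \<Rightarrow> 'q) \<Rightarrow> bool" where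
  "superlinear_family Q T \<longleftrightarrow>
     (\<forall>\<epsilon> \<ge> 0. translation Q (T \<epsilon>)) \<and>
     (\<forall>\<epsilon>1 \<ge> 0. \<forall>\<epsilon>2 \<ge> 0. \<forall>q \<in> Field Q. (T \<epsilon>2 (T \<epsilon>1 q), T (\<epsilon>1 + \<epsilon>2) q) \<in> Q)"

definition shiftQ :: "(real \<Rightarrow> 'q \<Rightarrow> 'q) \<Rightarrow> real \<Rightarrow> ('q, 'o, 'a) pmod \<Rightarrow> ('q, 'o, 'a) pmod" where
  "shiftQ T \<epsilon> M = pull (T \<epsilon>) M"

definition shiftQ_nt :: "(real \<Rightarrow> 'q \<Rightarrow> 'q) \<Rightarrow> real \<Rightarrow> ('q \<Rightarrow> 'a) \<Rightarrow> 'q \<Rightarrow> 'a" where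
  "shiftQ_nt T \<epsilon> \<phi> = pull_nt (T \<epsilon>) \<phi>"

definition etaQ :: "(real \<Rightarrow> 'q \<Rightarrow> 'q) \<Rightarrow> real \<Rightarrow> ('q, 'o, 'a) pmod \<Rightarrow> 'q \<Rightarrow> 'a" where
  "etaQ T \<epsilon> M q = amap M (q, T \<epsilon> q)"

definition etaQ2 :: "(real \<Rightarrow> 'q \<Rightarrow> 'q) \<Rightarrow> real \<Rightarrow> real \<Rightarrow> ('q, 'o, 'a) pmod \<Rightarrow> 'q \<Rightarrow> 'a" where
  "etaQ2 T \<epsilon> \<epsilon>' M q = amap M (T \<epsilon> q, T \<epsilon>' q)"

text \<open>The domain of \<open>\<Sigma>\<close> is \<open>M \<circ> T \<epsilon>1 \<circ> T \<epsilon>2\<close>: shifting by \<open>\<epsilon>2\<close> last means applying \<open>T \<epsilon>2\<close> first.\<close>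

definition SigmaQ :: "(real \<Rightarrow> 'q \<Rightarrow> 'q) \<Rightarrow> real \<Rightarrow> real \<Rightarrow> ('q, 'o, 'a) pmod \<Rightarrow> 'q \<Rightarrow> 'a" where
  "SigmaQ T \<epsilon>1 \<epsilon>2 M q = amap M (T \<epsilon>1 (T \<epsilon>2 q), T (\<epsilon>1 + \<epsilon>2) q)"

definition weak_interleavingQ :: "'q rel \<Rightarrow> (real \<Rightarrow> 'q \<Rightarrow> 'q) \<Rightarrow> ('o, 'a) cat \<Rightarrow> real \<Rightarrow>
    ('q, 'o, 'a) pmod \<Rightarrow> ('q, 'o, 'a) pmod \<Rightarrow> ('q \<Rightarrow> 'a) \<Rightarrow> ('q \<Rightarrow> 'a) \<Rightarrow> bool" where
  "weak_interleavingQ Q T C \<epsilon> M N \<phi> \<psi> \<longleftrightarrow>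
     pmod_hom Q C M (shiftQ T \<epsilon> N) \<phi> \<and>
     pmod_hom Q C N (shiftQ T \<epsilon> M) \<psi> \<and>
     (\<forall>q \<in> Field Q.
        vcomp C (SigmaQ T \<epsilon> \<epsilon> M) (vcomp C (shiftQ_nt T \<epsilon> \<psi>) \<phi>) q =
        vcomp C (etaQ2 T 0 (2 * \<epsilon>) M) (etaQ T 0 M) q) \<and>
     (\<forall>q \<in> Field Q.
        vcomp C (SigmaQ T \<epsilon> \<epsilon> N) (vcomp C (shiftQ_nt T \<epsilon> \<phi>) \<psi>) q =
        vcomp C (etaQ2 T 0 (2 * \<epsilon>) N) (etaQ T 0 N) q)"

definition distQ :: "'q rel \<Rightarrow> (real \<Rightarrow> 'q \<Rightarrow> 'q) \<Rightarrow> ('o, 'a) cat \<Rightarrow>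
    ('q, 'o, 'a) pmod \<Rightarrow> ('q, 'o, 'a) pmod \<Rightarrow> ennreal" where
  "distQ Q T C M N =
     (INF \<epsilon> \<in> {\<epsilon>. 0 \<le> \<epsilon> \<and> (\<exists>\<phi> \<psi>. weak_interleavingQ Q T C \<epsilon> M N \<phi> \<psi>)}. ennreal \<epsilon>)"


section \<open>Weak interleavings relative to a map of posets\<close>

definition shiftP :: "'p rel \<Rightarrow> 'q rel \<Rightarrow> ('p \<Rightarrow> 'q) \<Rightarrow> (real \<Rightarrow> 'q \<Rightarrow> 'q) \<Rightarrow> ('o, 'a) cat \<Rightarrow>
    real \<Rightarrow> ('p, 'o, 'a) pmod \<Rightarrow> ('p, 'o, 'a) pmod" where
  "shiftP P Q f T C \<epsilon> M = pull f (shiftQ T \<epsilon> (push P Q f C M))"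

definition shiftP_nt :: "'p rel \<Rightarrow> 'q rel \<Rightarrow> ('p \<Rightarrow> 'q) \<Rightarrow> (real \<Rightarrow> 'q \<Rightarrow> 'q) \<Rightarrow> ('o, 'a) cat \<Rightarrow>
    real \<Rightarrow> ('p, 'o, 'a) pmod \<Rightarrow> ('p, 'o, 'a) pmod \<Rightarrow> ('p \<Rightarrow> 'a) \<Rightarrow> 'p \<Rightarrow> 'a" where
  "shiftP_nt P Q f T C \<epsilon> M N \<phi> = pull_nt f (shiftQ_nt T \<epsilon> (push_nt P Q f C M N \<phi>))"

definition etaP :: "'p rel \<Rightarrow> 'q rel \<Rightarrow> ('p \<Rightarrow> 'q) \<Rightarrow> (real \<Rightarrow> 'q \<Rightarrow> 'q) \<Rightarrow> ('o, 'a) cat \<Rightarrow>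
    real \<Rightarrow> ('p, 'o, 'a) pmod \<Rightarrow> 'p \<Rightarrow> 'a" where
  "etaP P Q f T C \<epsilon> M =
     vcomp C (pull_nt f (etaQ T \<epsilon> (push P Q f C M))) (adj_unit P Q f C M)"

definition etaP2 :: "'p rel \<Rightarrow> 'q rel \<Rightarrow> ('p \<Rightarrow> 'q) \<Rightarrow> (real \<Rightarrow> 'q \<Rightarrow> 'q) \<Rightarrow> ('o, 'a) cat \<Rightarrow>
    real \<Rightarrow> real \<Rightarrow> ('p, 'o, 'a) pmod \<Rightarrow> 'p \<Rightarrow> 'a" where
  "etaP2 P Q f T C \<epsilon> \<epsilon>' M = pull_nt f (etaQ2 T \<epsilon> \<epsilon>' (push P Q f C M))"

definition SigmaP :: "'p rel \<Rightarrow> 'q rel \<Rightarrow> ('p \<Rightarrow> 'q) \<Rightarrow> (real \<Rightarrow> 'q \<Rightarrow> 'q) \<Rightarrow> ('o, 'a) cat \<Rightarrow>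
    real \<Rightarrow> real \<Rightarrow> ('p, 'o, 'a) pmod \<Rightarrow> 'p \<Rightarrow> 'a" where
  "SigmaP P Q f T C \<epsilon>1 \<epsilon>2 M =
     vcomp C (pull_nt f (SigmaQ T \<epsilon>1 \<epsilon>2 (push P Q f C M)))
       (pull_nt f (shiftQ_nt T \<epsilon>2 (adj_counit P Q f C (shiftQ T \<epsilon>1 (push P Q f C M)))))"

definition weak_interleavingP :: "'p rel \<Rightarrow> 'q rel \<Rightarrow> ('p \<Rightarrow> 'q) \<Rightarrow> (real \<Rightarrow> 'q \<Rightarrow> 'q) \<Rightarrow>
    ('o, 'a) cat \<Rightarrow> real \<Rightarrow> ('p, 'o, 'a) pmod \<Rightarrow> ('p, 'o, 'a) pmod \<Rightarrow>
    ('p \<Rightarrow> 'a) \<Rightarrow> ('p \<Rightarrow> 'a) \<Rightarrow> bool" where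
  "weak_interleavingP P Q f T C \<epsilon> M N \<phi> \<psi> \<longleftrightarrow>
     pmod_hom P C M (shiftP P Q f T C \<epsilon> N) \<phi> \<and>
     pmod_hom P C N (shiftP P Q f T C \<epsilon> M) \<psi> \<and>
     (\<forall>p \<in> Field P.
        vcomp C (SigmaP P Q f T C \<epsilon> \<epsilon> M)
          (vcomp C (shiftP_nt P Q f T C \<epsilon> N (shiftP P Q f T C \<epsilon> M) \<psi>) \<phi>) p =
        vcomp C (etaP2 P Q f T C 0 (2 * \<epsilon>) M) (etaP P Q f T C 0 M) p) \<and>
     (\<forall>p \<in> Field P.
        vcomp C (SigmaP P Q f T C \<epsilon> \<epsilon> N)
          (vcomp C (shiftP_nt P Q f T C \<epsilon> M (shiftP P Q f T C \<epsilon> N) \<phi>) \<psi>) p =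
        vcomp C (etaP2 P Q f T C 0 (2 * \<epsilon>) N) (etaP P Q f T C 0 N) p)"

definition distP :: "'p rel \<Rightarrow> 'q rel \<Rightarrow> ('p \<Rightarrow> 'q) \<Rightarrow> (real \<Rightarrow> 'q \<Rightarrow> 'q) \<Rightarrow> ('o, 'a) cat \<Rightarrow>
    ('p, 'o, 'a) pmod \<Rightarrow> ('p, 'o, 'a) pmod \<Rightarrow> ennreal" where
  "distP P Q f T C M N =
     (INF \<epsilon> \<in> {\<epsilon>. 0 \<le> \<epsilon> \<and> (\<exists>\<phi> \<psi>. weak_interleavingP P Q f T C \<epsilon> M N \<phi> \<psi>)}. ennreal \<epsilon>)"

end

theory Submission
  imports Defs
begin

text \<open>
  The isometry is the adjunction \<open>f\<^sub>* \<stileturn> f\<^sup>*\<close> applied to interleavings. A relative morphism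
  \<open>\<phi> : M \<rightarrow> f\<^sup>* T\<^sub>\<epsilon>\<^sup>* f\<^sub>* N\<close> is the same thing as its transpose \<open>\<Phi> : f\<^sub>* M \<rightarrow> T\<^sub>\<epsilon>\<^sup>* f\<^sub>* N\<close>, so pairs of
  candidate interleaving morphisms over \<open>P\<close> and over \<open>Q\<close> correspond for each fixed \<open>\<epsilon>\<close>. What remains
  is that the interleaving equations correspond.

  Write \<open>\<Phi>\<^sup>\<sharp>\<close> for the transpose of \<open>\<Phi> : f\<^sub>* M \<rightarrow> K\<close>, that is, \<open>\<Phi>\<close> restricted along the unit. The map
  \<open>\<Phi> \<mapsto> \<Phi>\<^sup>\<sharp>\<close> is injective (\<open>sharp_eq_iff\<close>), because an arrow out of \<open>(f\<^sub>* M)(q)\<close> is determined by its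
  composites with the colimit legs, and naturality of \<open>\<Phi>\<close> moves the leg of \<open>p\<close> from \<open>q\<close> back
  to \<open>f p\<close>. Now both sides of the interleaving equation for \<open>f\<^sub>* M\<close> over \<open>Q\<close> are morphisms
  \<open>f\<^sub>* M \<rightarrow> T\<^bsub>2\<epsilon>\<^esub>\<^sup>* f\<^sub>* M\<close>, and their transposes are precisely the two sides of the relative equation
  for \<open>M\<close>: the counit in the relative \<open>\<Sigma>\<close>, composed with \<open>f\<^sub>* \<psi>\<close>, is the transpose of \<open>\<psi>\<close>
  (\<open>counit_push_nt\<close>). By injectivity, one equation holds if and only if the other does
  (\<open>roundtrip_iff\<close>). Hence the two distances are infima of the same set of \<open>\<epsilon>\<close>.
\<close>

section \<open>Modules over a poset\<close>

lemma poset_cat_simps [simp]: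
  "Obj (poset_cat P) = Field P" "Arr (poset_cat P) = P"
  "Dom (poset_cat P) = fst" "Cod (poset_cat P) = snd"
  "Ide (poset_cat P) x = (x, x)" "Cmp (poset_cat P) v u = (fst u, snd v)"
  by (simp_all add: poset_cat_def)

lemma is_pmod_iff:
  "is_pmod P C M \<longleftrightarrow>
     (\<forall>x \<in> Field P. omap M x \<in> Obj C) \<and>
     (\<forall>x y. (x, y) \<in> P \<longrightarrow> amap M (x, y) \<in> hom C (omap M x) (omap M y)) \<and>
     (\<forall>x \<in> Field P. amap M (x, x) = Ide C (omap M x)) \<and>
     (\<forall>x y z. (x, y) \<in> P \<longrightarrow> (y, z) \<in> P \<longrightarrow>
        amap M (x, z) = amap M (y, z) \<odot>\<^bsub>C\<^esub> amap M (x, y))"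
  unfolding is_pmod_def is_functor_def by (simp add: Ball_def split_paired_All)

lemma pmod_hom_iff:
  "pmod_hom P C M N \<phi> \<longleftrightarrow>
     (\<forall>x \<in> Field P. \<phi> x \<in> hom C (omap M x) (omap N x)) \<and>
     (\<forall>x y. (x, y) \<in> P \<longrightarrow> \<phi> y \<odot>\<^bsub>C\<^esub> amap M (x, y) = amap N (x, y) \<odot>\<^bsub>C\<^esub> \<phi> x)"
  unfolding pmod_hom_def nat_trans_def by (simp add: Ball_def split_paired_All)

lemma category_poset_cat:
  assumes "Partial_order P"
  shows "category (poset_cat P)"
proof -
  have refl: "(x, x) \<in> P" if "x \<in> Field P" for x
    using assms that by (auto simp: partial_order_on_def preorder_on_def refl_on_def)
  have trans: "(x, z) \<in> P" if "(x, y) \<in> P" "(y, z) \<in> P" for x y z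
    using assms that by (auto simp: partial_order_on_def preorder_on_def elim: transE)
  show ?thesis
    by unfold_locales (auto simp: hom_def refl trans FieldI1 FieldI2)
qed

lemma pull_simps [simp]:
  "omap (pull g M) x = omap M (g x)" "amap (pull g M) (x, y) = amap M (g x, g y)"
  by (simp_all add: pull_def)

lemma pull_ident [simp]: "pull (\<lambda>x. x) M = M"
  by (simp add: pull_def)

lemma pull_pull [simp]: "pull g (pull h M) = pull (\<lambda>x. h (g x)) M"
  by (simp add: pull_def fun_eq_iff)

lemma poset_mapD:
  assumes "poset_map P Q g"
  shows "(x, y) \<in> P \<Longrightarrow> (g x, g y) \<in> Q"
    and "x \<in> Field P \<Longrightarrow> g x \<in> Field Q"
  using assms by (auto simp: poset_map_def compat_def Field_def)

lemma is_pmod_pull: "poset_map P Q g \<Longrightarrow> is_pmod Q C M \<Longrightarrow> is_pmod P C (pull g M)"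
  by (simp add: is_pmod_iff poset_mapD)

lemma pmod_hom_pull:
  assumes "poset_map P Q g" "pmod_hom Q C M N \<phi>"
  shows "pmod_hom P C (pull g M) (pull g N) (pull_nt g \<phi>)"
  using assms(2) poset_mapD[OF assms(1)] by (simp add: pmod_hom_iff pull_nt_def)

text \<open>
  The maps \<open>\<eta>\<close> and \<open>\<Sigma>\<close> over \<open>Q\<close> are all of this form, with \<open>s\<close> and \<open>t\<close> composites of translations.
\<close>

lemma pmod_hom_internal:
  assumes "poset_map P Q s" "poset_map P Q t" "\<And>x. x \<in> Field P \<Longrightarrow> (s x, t x) \<in> Q"
    and M: "is_pmod Q C M"
  shows "pmod_hom P C (pull s M) (pull t M) (\<lambda>x. amap M (s x, t x))"
proof -
  have "amap M (s y, t y) \<odot>\<^bsub>C\<^esub> amap M (s x, s y) = amap M (t x, t y) \<odot>\<^bsub>C\<^esub> amap M (s x, t x)"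
    if "(x, y) \<in> P" for x y
  proof -
    have "(s x, s y) \<in> Q" "(s y, t y) \<in> Q" "(s x, t x) \<in> Q" "(t x, t y) \<in> Q"
      using assms(1-3) that by (auto simp: poset_mapD FieldI1 FieldI2)
    then show ?thesis
      using M unfolding is_pmod_iff by metis
  qed
  then show ?thesis
    using assms by (simp add: pmod_hom_iff is_pmod_iff)
qed

context category
begin

lemma hom_Obj: "u \<in> hom C x y \<Longrightarrow> x \<in> Obj C" "u \<in> hom C x y \<Longrightarrow> y \<in> Obj C"
  using Dom_Obj Cod_Obj by (auto simp: hom_def)

lemma pmod_hom_vcomp:
  assumes L: "is_pmod P C L" and M: "is_pmod P C M" and N: "is_pmod P C N"
    and \<phi>: "pmod_hom P C L M \<phi>" and \<psi>: "pmod_hom P C M N \<psi>"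
  shows "pmod_hom P C L N (vcomp C \<psi> \<phi>)"
  unfolding pmod_hom_iff
proof (intro conjI ballI allI impI)
  fix x assume "x \<in> Field P"
  then show "vcomp C \<psi> \<phi> x \<in> hom C (omap L x) (omap N x)"
    using \<phi> \<psi> by (auto simp: pmod_hom_iff vcomp_def intro: Cmp_hom)
next
  fix x y assume xy: "(x, y) \<in> P"
  then have x: "x \<in> Field P" and y: "y \<in> Field P"
    by (auto simp: FieldI1 FieldI2)
  have h: "\<phi> x \<in> hom C (omap L x) (omap M x)" "\<phi> y \<in> hom C (omap L y) (omap M y)"
      "\<psi> x \<in> hom C (omap M x) (omap N x)" "\<psi> y \<in> hom C (omap M y) (omap N y)"
    using \<phi> \<psi> x y by (auto simp: pmod_hom_iff)
  have a: "amap L (x, y) \<in> hom C (omap L x) (omap L y)"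
      "amap M (x, y) \<in> hom C (omap M x) (omap M y)"
      "amap N (x, y) \<in> hom C (omap N x) (omap N y)"
    using L M N xy by (auto simp: is_pmod_iff)
  have "(\<psi> y \<odot> \<phi> y) \<odot> amap L (x, y) = \<psi> y \<odot> (amap M (x, y) \<odot> \<phi> x)"
    using \<phi> xy Cmp_assoc[OF a(1) h(2) h(4)] by (simp add: pmod_hom_iff)
  also have "\<dots> = (amap N (x, y) \<odot> \<psi> x) \<odot> \<phi> x"
    using \<psi> xy Cmp_assoc[OF h(1) a(2) h(4)] by (simp add: pmod_hom_iff)
  also have "\<dots> = amap N (x, y) \<odot> (\<psi> x \<odot> \<phi> x)"
    by (rule Cmp_assoc[OF h(1) h(3) a(3)])
  finally show "vcomp C \<psi> \<phi> y \<odot> amap L (x, y) = amap N (x, y) \<odot> vcomp C \<psi> \<phi> x"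
    by (simp add: vcomp_def)
qed

end


section \<open>The pushforward as a pointwise colimit\<close>

locale pushforward =
  fixes P :: "'p rel" and Q :: "'q rel" and f :: "'p \<Rightarrow> 'q" and C :: "('o, 'a) cat" (structure)
  assumes f: "poset_map P Q f"
    and cocomplete: "cocomplete TYPE('p) TYPE('p \<times> 'p) C"
begin

sublocale category C
  using cocomplete by (simp add: cocomplete_def)

abbreviation lan :: "('p, 'o, 'a) pmod \<Rightarrow> ('q, 'o, 'a) pmod" where
  "lan \<equiv> push P Q f C"

abbreviation lan_leg :: "('p, 'o, 'a) pmod \<Rightarrow> 'q \<Rightarrow> 'p \<Rightarrow> 'a" where
  "lan_leg M q \<equiv> leg (slice P Q f q) C M"

lemma P: "Partial_order P" and Q: "Partial_order Q"
  using f by (simp_all add: poset_map_def)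

lemma P_refl: "x \<in> Field P \<Longrightarrow> (x, x) \<in> P"
  using P by (auto simp: partial_order_on_def preorder_on_def refl_on_def)

lemma Q_refl: "x \<in> Field Q \<Longrightarrow> (x, x) \<in> Q"
  using Q by (auto simp: partial_order_on_def preorder_on_def refl_on_def)

lemma Q_trans: "(x, y) \<in> Q \<Longrightarrow> (y, z) \<in> Q \<Longrightarrow> (x, z) \<in> Q"
  using Q by (auto simp: partial_order_on_def preorder_on_def elim: transE)

lemmas f_mono = poset_mapD[OF f]

lemma Field_slice: "Field (Restr P {p \<in> Field P. (f p, q) \<in> Q}) = {p \<in> Field P. (f p, q) \<in> Q}"
  using P_refl by (auto simp: Field_def)

lemma category_slice: "category (slice P Q f q)"
  unfolding slice_def by (rule category_poset_cat[OF Partial_order_Restr[OF P]])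

lemma functor_slice:
  assumes "is_pmod P C M"
  shows "is_functor (slice P Q f q) C M"
proof -
  have "is_pmod (Restr P {p \<in> Field P. (f p, q) \<in> Q}) C M"
    using assms unfolding is_pmod_iff Field_slice by auto
  then show ?thesis
    by (simp add: slice_def is_pmod_def)
qed

lemma colimit_slice:
  assumes "is_pmod P C M"
  shows "colimit (slice P Q f q) C M (omap (lan M) q) (lan_leg M q)"
proof -
  have "\<exists>c \<iota>. colimit (slice P Q f q) C M c \<iota>"
    using cocomplete category_slice functor_slice[OF assms] unfolding cocomplete_def by blast
  then have "\<exists>z. case z of (c, \<iota>) \<Rightarrow> colimit (slice P Q f q) C M c \<iota>"
    by auto
  then have "case colim_cocone (slice P Q f q) C M of (c, \<iota>) \<Rightarrow> colimit (slice P Q f q) C M c \<iota>"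
    unfolding colim_cocone_def by (rule someI_ex)
  then show ?thesis
    by (simp add: push_def colim_def leg_def split_beta)
qed

text \<open>
  By monotonicity of \<open>f\<close> the index poset at \<open>q\<close> is a lower set of \<open>P\<close>, so an arrow belongs to it as
  soon as its codomain does.
\<close>

lemma cocone_slice_iff:
  "cocone (slice P Q f q) C M d \<kappa> \<longleftrightarrow>
     d \<in> Obj C \<and>
     (\<forall>p \<in> Field P. (f p, q) \<in> Q \<longrightarrow> \<kappa> p \<in> hom C (omap M p) d) \<and>
     (\<forall>p p'. (p, p') \<in> P \<longrightarrow> (f p', q) \<in> Q \<longrightarrow> \<kappa> p' \<odot> amap M (p, p') = \<kappa> p)"
proof -
  have "(p, p') \<in> Restr P {p \<in> Field P. (f p, q) \<in> Q} \<longleftrightarrow> (p, p') \<in> P \<and> (f p', q) \<in> Q" for p p'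
    using f_mono Q_trans by (auto simp: FieldI1 FieldI2) blast
  then show ?thesis
    unfolding cocone_def slice_def poset_cat_simps Field_slice
    by (simp add: Ball_def split_paired_All imp_conjL del: Int_iff)
qed

lemma lan_Obj: "is_pmod P C M \<Longrightarrow> omap (lan M) q \<in> Obj C"
  using colimit_slice unfolding colimit_def cocone_def by blast

lemma lan_leg_hom:
  "is_pmod P C M \<Longrightarrow> p \<in> Field P \<Longrightarrow> (f p, q) \<in> Q \<Longrightarrow>
     lan_leg M q p \<in> hom C (omap M p) (omap (lan M) q)"
  using colimit_slice unfolding colimit_def cocone_slice_iff by blast

lemma lan_leg_amap:
  "is_pmod P C M \<Longrightarrow> (p, p') \<in> P \<Longrightarrow> (f p', q) \<in> Q \<Longrightarrow> lan_leg M q p' \<odot> amap M (p, p') = lan_leg M q p"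
  using colimit_slice unfolding colimit_def cocone_slice_iff by blast

lemma desc_ex1:
  assumes "is_pmod P C M" "cocone (slice P Q f q) C M d \<kappa>"
  shows "\<exists>!u. u \<in> hom C (omap (lan M) q) d \<and>
           (\<forall>p \<in> Field P. (f p, q) \<in> Q \<longrightarrow> u \<odot> lan_leg M q p = \<kappa> p)"
proof -
  have "\<exists>!u. u \<in> hom C (omap (lan M) q) d \<and>
      (\<forall>p \<in> Obj (slice P Q f q). u \<odot> lan_leg M q p = \<kappa> p)"
    using colimit_slice[OF assms(1)] assms(2) unfolding colimit_def by blast
  then show ?thesis
    by (simp add: slice_def Field_slice imp_conjL Ball_def)
qed

lemma desc_slice:
  assumes "is_pmod P C M" "cocone (slice P Q f q) C M d \<kappa>"
  shows desc_hom: "desc (slice P Q f q) C M d \<kappa> \<in> hom C (omap (lan M) q) d"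
    and desc_leg: "\<And>p. p \<in> Field P \<Longrightarrow> (f p, q) \<in> Q \<Longrightarrow>
          desc (slice P Q f q) C M d \<kappa> \<odot> lan_leg M q p = \<kappa> p"
proof -
  have eq: "desc (slice P Q f q) C M d \<kappa> =
      (THE u. u \<in> hom C (omap (lan M) q) d \<and>
         (\<forall>p \<in> Field P. (f p, q) \<in> Q \<longrightarrow> u \<odot> lan_leg M q p = \<kappa> p))"
    unfolding desc_def push_def by (simp add: slice_def Field_slice imp_conjL Ball_def)
  note * = theI'[OF desc_ex1[OF assms], folded eq]
  show "desc (slice P Q f q) C M d \<kappa> \<in> hom C (omap (lan M) q) d"
    using * by blast
  show "desc (slice P Q f q) C M d \<kappa> \<odot> lan_leg M q p = \<kappa> p"
    if "p \<in> Field P" "(f p, q) \<in> Q" for p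
    using * that by blast
qed

text \<open>
  The legs of a colimit are jointly epic: \<open>v\<close> composed with the legs is a cocone, and both \<open>u\<close>
  and \<open>v\<close> are factorizations of it.
\<close>

lemma lan_arrow_eqI:
  assumes M: "is_pmod P C M"
    and u: "u \<in> hom C (omap (lan M) q) d" and v: "v \<in> hom C (omap (lan M) q) d"
    and eq: "\<And>p. p \<in> Field P \<Longrightarrow> (f p, q) \<in> Q \<Longrightarrow> u \<odot> lan_leg M q p = v \<odot> lan_leg M q p"
  shows "u = v"
proof -
  have "v \<odot> lan_leg M q p' \<odot> amap M (p, p') = v \<odot> lan_leg M q p"
    if "(p, p') \<in> P" "(f p', q) \<in> Q" for p p'
    using lan_leg_amap[OF M that] by simp
  moreover have "(v \<odot> lan_leg M q p') \<odot> amap M (p, p') = v \<odot> (lan_leg M q p' \<odot> amap M (p, p'))"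
    if "(p, p') \<in> P" "(f p', q) \<in> Q" for p p'
    using M that by (intro Cmp_assoc[OF _ lan_leg_hom v]) (auto simp: is_pmod_iff FieldI2)
  ultimately have "cocone (slice P Q f q) C M d (\<lambda>p. v \<odot> lan_leg M q p)"
    using hom_Obj[OF v] Cmp_hom[OF lan_leg_hom[OF M] v] by (simp add: cocone_slice_iff)
  from desc_ex1[OF M this] show ?thesis
    using u v eq by blast
qed

lemma lan_amap:
  assumes M: "is_pmod P C M" and q: "(q, q') \<in> Q"
  shows lan_amap_hom: "amap (lan M) (q, q') \<in> hom C (omap (lan M) q) (omap (lan M) q')"
    and lan_amap_leg: "\<And>p. p \<in> Field P \<Longrightarrow> (f p, q) \<in> Q \<Longrightarrow>
          amap (lan M) (q, q') \<odot> lan_leg M q p = lan_leg M q' p"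
proof -
  have eq: "amap (lan M) (q, q') = desc (slice P Q f q) C M (omap (lan M) q') (lan_leg M q')"
    by (simp add: push_def)
  have "cocone (slice P Q f q) C M (omap (lan M) q') (lan_leg M q')"
    using Q_trans[OF _ q] M by (auto simp: cocone_slice_iff lan_Obj lan_leg_hom lan_leg_amap)
  note * = desc_slice[OF M this]
  show "amap (lan M) (q, q') \<in> hom C (omap (lan M) q) (omap (lan M) q')"
    using *(1) eq by simp
  show "amap (lan M) (q, q') \<odot> lan_leg M q p = lan_leg M q' p"
    if "p \<in> Field P" "(f p, q) \<in> Q" for p
    using *(2) eq that by simp
qed

lemma is_pmod_lan:
  assumes M: "is_pmod P C M"
  shows "is_pmod Q C (lan M)"
  unfolding is_pmod_iff
proof (intro conjI ballI allI impI)
  fix q assume "q \<in> Field Q"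
  then have qq: "(q, q) \<in> Q"
    by (rule Q_refl)
  show "omap (lan M) q \<in> Obj C"
    by (rule lan_Obj[OF M])
  show "amap (lan M) (q, q) = Ide C (omap (lan M) q)"
    by (rule lan_arrow_eqI[OF M lan_amap_hom[OF M qq] Ide_hom[OF lan_Obj[OF M]]])
      (simp add: lan_amap_leg[OF M qq] Cmp_Ide_left[OF lan_leg_hom[OF M]])
next
  fix q q' assume "(q, q') \<in> Q"
  then show "amap (lan M) (q, q') \<in> hom C (omap (lan M) q) (omap (lan M) q')"
    by (rule lan_amap_hom[OF M])
next
  fix x y z assume xy: "(x, y) \<in> Q" and yz: "(y, z) \<in> Q"
  note xz = Q_trans[OF xy yz]
  note hxy = lan_amap_hom[OF M xy] and hyz = lan_amap_hom[OF M yz]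
  show "amap (lan M) (x, z) = amap (lan M) (y, z) \<odot> amap (lan M) (x, y)"
  proof (rule lan_arrow_eqI[OF M lan_amap_hom[OF M xz] Cmp_hom[OF hxy hyz]])
    fix p assume p: "p \<in> Field P" "(f p, x) \<in> Q"
    then show "amap (lan M) (x, z) \<odot> lan_leg M x p
        = (amap (lan M) (y, z) \<odot> amap (lan M) (x, y)) \<odot> lan_leg M x p"
      using Cmp_assoc[OF lan_leg_hom[OF M p] hxy hyz] Q_trans[OF p(2) xy]
      by (simp add: lan_amap_leg[OF M] xy yz xz)
  qed
qed


section \<open>Transposition\<close>

text \<open>
  The two halves of the hom-set bijection of the adjunction: \<open>flat\<close> sends \<open>M \<rightarrow> f\<^sup>* K\<close> to
  \<open>f\<^sub>* M \<rightarrow> K\<close>, and \<open>sharp\<close> goes back.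
\<close>

definition flat :: "('p, 'o, 'a) pmod \<Rightarrow> ('q, 'o, 'a) pmod \<Rightarrow> ('p \<Rightarrow> 'a) \<Rightarrow> 'q \<Rightarrow> 'a" where
  "flat M K \<phi> q = desc (slice P Q f q) C M (omap K q) (\<lambda>p. amap K (f p, q) \<odot> \<phi> p)"

definition sharp :: "('p, 'o, 'a) pmod \<Rightarrow> ('q \<Rightarrow> 'a) \<Rightarrow> 'p \<Rightarrow> 'a" where
  "sharp M \<Phi> p = \<Phi> (f p) \<odot> lan_leg M (f p) p"

lemma sharp_vcomp_adj_unit: "sharp M \<Phi> = vcomp C (pull_nt f \<Phi>) (adj_unit P Q f C M)"
  by (simp add: fun_eq_iff sharp_def vcomp_def pull_nt_def adj_unit_def)

lemma pmod_hom_adj_unit: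
  assumes M: "is_pmod P C M"
  shows "pmod_hom P C M (pull f (lan M)) (adj_unit P Q f C M)"
proof -
  have "lan_leg M (f y) y \<odot> amap M (x, y) = amap (lan M) (f x, f y) \<odot> lan_leg M (f x) x"
    if xy: "(x, y) \<in> P" for x y
  proof -
    have x: "x \<in> Field P" and y: "y \<in> Field P"
      using xy by (auto simp: FieldI1 FieldI2)
    show ?thesis
      using lan_leg_amap[OF M xy Q_refl[OF f_mono(2)[OF y]]]
        lan_amap_leg[OF M f_mono(1)[OF xy] x Q_refl[OF f_mono(2)[OF x]]] by simp
  qed
  then show ?thesis
    by (simp add: pmod_hom_iff adj_unit_def lan_leg_hom[OF M] Q_refl f_mono(2))
qed

lemma pmod_hom_sharp:
  assumes M: "is_pmod P C M" and K: "is_pmod Q C K" and \<Phi>: "pmod_hom Q C (lan M) K \<Phi>"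
  shows "pmod_hom P C M (pull f K) (sharp M \<Phi>)"
  unfolding sharp_vcomp_adj_unit
  by (rule pmod_hom_vcomp[OF M is_pmod_pull[OF f is_pmod_lan[OF M]] is_pmod_pull[OF f K]
        pmod_hom_adj_unit[OF M] pmod_hom_pull[OF f \<Phi>]])

text \<open>
  The leg of \<open>p\<close> at \<open>q\<close> is the leg at \<open>f p\<close> followed by the structure map from \<open>f p\<close> to \<open>q\<close>, so
  naturality computes \<open>\<Phi>\<close> at \<open>q\<close> on that leg from the value of \<open>\<Phi>\<close> at \<open>f p\<close> alone.
\<close>

lemma pmod_hom_leg:
  assumes M: "is_pmod P C M" and K: "is_pmod Q C K" and \<Phi>: "pmod_hom Q C (lan M) K \<Phi>"
    and p: "p \<in> Field P" and q: "(f p, q) \<in> Q"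
  shows "\<Phi> q \<odot> lan_leg M q p = amap K (f p, q) \<odot> sharp M \<Phi> p"
proof -
  have fp: "f p \<in> Field Q" "(f p, f p) \<in> Q" and qF: "q \<in> Field Q"
    using p q f_mono(2) Q_refl by (auto simp: FieldI2)
  note i = lan_leg_hom[OF M p fp(2)]
  have h: "\<Phi> (f p) \<in> hom C (omap (lan M) (f p)) (omap K (f p))"
      "\<Phi> q \<in> hom C (omap (lan M) q) (omap K q)"
    using \<Phi> fp qF by (auto simp: pmod_hom_iff)
  have k: "amap K (f p, q) \<in> hom C (omap K (f p)) (omap K q)"
    using K q by (simp add: is_pmod_iff)
  have "\<Phi> q \<odot> lan_leg M q p = \<Phi> q \<odot> (amap (lan M) (f p, q) \<odot> lan_leg M (f p) p)"
    by (simp add: lan_amap_leg[OF M q p fp(2)])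
  also have "\<dots> = (\<Phi> q \<odot> amap (lan M) (f p, q)) \<odot> lan_leg M (f p) p"
    by (rule Cmp_assoc[OF i lan_amap_hom[OF M q] h(2), symmetric])
  also have "\<dots> = (amap K (f p, q) \<odot> \<Phi> (f p)) \<odot> lan_leg M (f p) p"
    using \<Phi> q by (simp add: pmod_hom_iff)
  also have "\<dots> = amap K (f p, q) \<odot> sharp M \<Phi> p"
    unfolding sharp_def by (rule Cmp_assoc[OF i h(1) k])
  finally show ?thesis .
qed

lemma sharp_eq_iff:
  assumes M: "is_pmod P C M" and K: "is_pmod Q C K"
    and \<Phi>: "pmod_hom Q C (lan M) K \<Phi>" and \<Psi>: "pmod_hom Q C (lan M) K \<Psi>"
  shows "(\<forall>p \<in> Field P. sharp M \<Phi> p = sharp M \<Psi> p) \<longleftrightarrow> (\<forall>q \<in> Field Q. \<Phi> q = \<Psi> q)"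
proof
  assume eq: "\<forall>p \<in> Field P. sharp M \<Phi> p = sharp M \<Psi> p"
  show "\<forall>q \<in> Field Q. \<Phi> q = \<Psi> q"
  proof
    fix q assume "q \<in> Field Q"
    then have "\<Phi> q \<in> hom C (omap (lan M) q) (omap K q)" "\<Psi> q \<in> hom C (omap (lan M) q) (omap K q)"
      using \<Phi> \<Psi> by (simp_all add: pmod_hom_iff)
    then show "\<Phi> q = \<Psi> q"
      by (rule lan_arrow_eqI[OF M])
        (simp add: pmod_hom_leg[OF M K \<Phi>] pmod_hom_leg[OF M K \<Psi>] eq)
  qed
qed (simp add: sharp_def f_mono(2))

lemma cocone_flat:
  assumes M: "is_pmod P C M" and K: "is_pmod Q C K" and \<phi>: "pmod_hom P C M (pull f K) \<phi>"
    and q: "q \<in> Field Q"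
  shows "cocone (slice P Q f q) C M (omap K q) (\<lambda>p. amap K (f p, q) \<odot> \<phi> p)"
  unfolding cocone_slice_iff
proof (intro conjI ballI allI impI)
  show "omap K q \<in> Obj C"
    using K q by (simp add: is_pmod_iff)
next
  fix p assume "p \<in> Field P" "(f p, q) \<in> Q"
  then show "amap K (f p, q) \<odot> \<phi> p \<in> hom C (omap M p) (omap K q)"
    using \<phi> K by (auto simp: pmod_hom_iff is_pmod_iff intro!: Cmp_hom)
next
  fix x y assume xy: "(x, y) \<in> P" and yq: "(f y, q) \<in> Q"
  have F: "x \<in> Field P" "y \<in> Field P"
    using xy by (auto simp: FieldI1 FieldI2)
  note fxy = f_mono(1)[OF xy]
  have h: "\<phi> x \<in> hom C (omap M x) (omap K (f x))" "\<phi> y \<in> hom C (omap M y) (omap K (f y))"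
      "amap M (x, y) \<in> hom C (omap M x) (omap M y)"
      "amap K (f x, f y) \<in> hom C (omap K (f x)) (omap K (f y))"
      "amap K (f y, q) \<in> hom C (omap K (f y)) (omap K q)"
    using \<phi> M K F xy yq fxy by (auto simp: pmod_hom_iff is_pmod_iff)
  have "(amap K (f y, q) \<odot> \<phi> y) \<odot> amap M (x, y) = amap K (f y, q) \<odot> (amap K (f x, f y) \<odot> \<phi> x)"
    using Cmp_assoc[OF h(3) h(2) h(5)] \<phi> xy by (simp add: pmod_hom_iff)
  also have "\<dots> = (amap K (f y, q) \<odot> amap K (f x, f y)) \<odot> \<phi> x"
    by (rule Cmp_assoc[OF h(1) h(4) h(5), symmetric])
  also have "amap K (f y, q) \<odot> amap K (f x, f y) = amap K (f x, q)"
    using K fxy yq unfolding is_pmod_iff by metis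
  finally show "(amap K (f y, q) \<odot> \<phi> y) \<odot> amap M (x, y) = amap K (f x, q) \<odot> \<phi> x" .
qed

lemma
  assumes M: "is_pmod P C M" and K: "is_pmod Q C K" and \<phi>: "pmod_hom P C M (pull f K) \<phi>"
    and q: "q \<in> Field Q"
  shows flat_hom: "flat M K \<phi> q \<in> hom C (omap (lan M) q) (omap K q)"
    and flat_leg: "\<And>p. p \<in> Field P \<Longrightarrow> (f p, q) \<in> Q \<Longrightarrow>
          flat M K \<phi> q \<odot> lan_leg M q p = amap K (f p, q) \<odot> \<phi> p"
  using desc_slice[OF M cocone_flat[OF assms]] by (simp_all add: flat_def)

lemma pmod_hom_flat:
  assumes M: "is_pmod P C M" and K: "is_pmod Q C K" and \<phi>: "pmod_hom P C M (pull f K) \<phi>"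
  shows "pmod_hom Q C (lan M) K (flat M K \<phi>)"
  unfolding pmod_hom_iff
proof (intro conjI ballI allI impI)
  fix q assume "q \<in> Field Q"
  then show "flat M K \<phi> q \<in> hom C (omap (lan M) q) (omap K q)"
    by (rule flat_hom[OF assms])
next
  fix x y assume xy: "(x, y) \<in> Q"
  have x: "x \<in> Field Q" and y: "y \<in> Field Q"
    using xy by (auto simp: FieldI1 FieldI2)
  note fx = flat_hom[OF assms x] and fy = flat_hom[OF assms y] and lxy = lan_amap_hom[OF M xy]
  have kxy: "amap K (x, y) \<in> hom C (omap K x) (omap K y)"
    using K xy by (simp add: is_pmod_iff)
  show "flat M K \<phi> y \<odot> amap (lan M) (x, y) = amap K (x, y) \<odot> flat M K \<phi> x"
  proof (rule lan_arrow_eqI[OF M Cmp_hom[OF lxy fy] Cmp_hom[OF fx kxy]])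
    fix p assume p: "p \<in> Field P" and px: "(f p, x) \<in> Q"
    note py = Q_trans[OF px xy] and i = lan_leg_hom[OF M p px]
    have h: "\<phi> p \<in> hom C (omap M p) (omap K (f p))"
        "amap K (f p, x) \<in> hom C (omap K (f p)) (omap K x)"
      using \<phi> K p px by (auto simp: pmod_hom_iff is_pmod_iff)
    have "(flat M K \<phi> y \<odot> amap (lan M) (x, y)) \<odot> lan_leg M x p = amap K (f p, y) \<odot> \<phi> p"
      using Cmp_assoc[OF i lxy fy]
      by (simp add: lan_amap_leg[OF M xy p px] flat_leg[OF assms y p py])
    also have "amap K (f p, y) = amap K (x, y) \<odot> amap K (f p, x)"
      using K px xy unfolding is_pmod_iff by metis
    also have "(amap K (x, y) \<odot> amap K (f p, x)) \<odot> \<phi> p = (amap K (x, y) \<odot> flat M K \<phi> x) \<odot> lan_leg M x p"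
      using Cmp_assoc[OF i fx kxy] Cmp_assoc[OF h kxy]
      by (simp add: flat_leg[OF assms x p px])
    finally show "(flat M K \<phi> y \<odot> amap (lan M) (x, y)) \<odot> lan_leg M x p
        = (amap K (x, y) \<odot> flat M K \<phi> x) \<odot> lan_leg M x p" .
  qed
qed

lemma sharp_flat:
  assumes M: "is_pmod P C M" and K: "is_pmod Q C K" and \<phi>: "pmod_hom P C M (pull f K) \<phi>"
    and p: "p \<in> Field P"
  shows "sharp M (flat M K \<phi>) p = \<phi> p"
proof -
  have fp: "f p \<in> Field Q"
    by (rule f_mono(2)[OF p])
  have "\<phi> p \<in> hom C (omap M p) (omap K (f p))"
    using \<phi> p by (simp add: pmod_hom_iff)
  moreover have "amap K (f p, f p) = Ide C (omap K (f p))"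
    using K fp by (simp add: is_pmod_iff)
  ultimately show ?thesis
    using flat_leg[OF M K \<phi> fp p Q_refl[OF fp]] by (simp add: sharp_def Cmp_Ide_left)
qed

lemma flat_sharp:
  assumes M: "is_pmod P C M" and K: "is_pmod Q C K" and \<Phi>: "pmod_hom Q C (lan M) K \<Phi>"
    and \<phi>: "pmod_hom P C M (pull f K) \<phi>" "\<And>p. p \<in> Field P \<Longrightarrow> \<phi> p = sharp M \<Phi> p"
    and q: "q \<in> Field Q"
  shows "flat M K \<phi> q = \<Phi> q"
  using sharp_eq_iff[OF M K pmod_hom_flat[OF M K \<phi>(1)] \<Phi>] sharp_flat[OF M K \<phi>(1)] \<phi>(2) q
  by simp

lemma adj_counit:
  assumes K: "is_pmod Q C K" and q: "q \<in> Field Q"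
  shows adj_counit_hom:
      "adj_counit P Q f C K q \<in> hom C (omap (lan (pull f K)) q) (omap K q)"
    and adj_counit_leg: "\<And>p. p \<in> Field P \<Longrightarrow> (f p, q) \<in> Q \<Longrightarrow>
      adj_counit P Q f C K q \<odot> lan_leg (pull f K) q p = amap K (f p, q)"
proof -
  have fK: "is_pmod P C (pull f K)"
    by (rule is_pmod_pull[OF f K])
  have "amap K (f p', q) \<odot> amap K (f p, f p') = amap K (f p, q)"
    if "(p, p') \<in> P" "(f p', q) \<in> Q" for p p'
    using K f_mono(1) that unfolding is_pmod_iff by metis
  then have "cocone (slice P Q f q) C (pull f K) (omap K q) (\<lambda>p. amap K (f p, q))"
    using K q by (simp add: cocone_slice_iff is_pmod_iff)
  note * = desc_slice[OF fK this]
  show "adj_counit P Q f C K q \<in> hom C (omap (lan (pull f K)) q) (omap K q)"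
    using *(1) by (simp add: adj_counit_def)
  show "adj_counit P Q f C K q \<odot> lan_leg (pull f K) q p = amap K (f p, q)"
    if "p \<in> Field P" "(f p, q) \<in> Q" for p
    using *(2) that by (simp add: adj_counit_def)
qed

lemma push_nt:
  assumes M: "is_pmod P C M" and N: "is_pmod P C N" and \<phi>: "pmod_hom P C M N \<phi>"
  shows push_nt_hom: "push_nt P Q f C M N \<phi> q \<in> hom C (omap (lan M) q) (omap (lan N) q)"
    and push_nt_leg: "\<And>p. p \<in> Field P \<Longrightarrow> (f p, q) \<in> Q \<Longrightarrow>
          push_nt P Q f C M N \<phi> q \<odot> lan_leg M q p = lan_leg N q p \<odot> \<phi> p"
proof -
  have eq: "push_nt P Q f C M N \<phi> q =
      desc (slice P Q f q) C M (omap (lan N) q) (\<lambda>p. lan_leg N q p \<odot> \<phi> p)"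
    by (simp add: push_nt_def push_def)
  have "(lan_leg N q y \<odot> \<phi> y) \<odot> amap M (x, y) = lan_leg N q x \<odot> \<phi> x"
    if xy: "(x, y) \<in> P" and yq: "(f y, q) \<in> Q" for x y
  proof -
    have F: "x \<in> Field P" "y \<in> Field P"
      using xy by (auto simp: FieldI1 FieldI2)
    have h: "\<phi> x \<in> hom C (omap M x) (omap N x)" "\<phi> y \<in> hom C (omap M y) (omap N y)"
      "amap M (x, y) \<in> hom C (omap M x) (omap M y)"
      "amap N (x, y) \<in> hom C (omap N x) (omap N y)"
      using \<phi> M N F xy by (auto simp: pmod_hom_iff is_pmod_iff)
    note i = lan_leg_hom[OF N F(2) yq]
    have "(lan_leg N q y \<odot> \<phi> y) \<odot> amap M (x, y) = lan_leg N q y \<odot> (amap N (x, y) \<odot> \<phi> x)"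
      using Cmp_assoc[OF h(3) h(2) i] \<phi> xy by (simp add: pmod_hom_iff)
    also have "\<dots> = (lan_leg N q y \<odot> amap N (x, y)) \<odot> \<phi> x"
      by (rule Cmp_assoc[OF h(1) h(4) i, symmetric])
    also have "\<dots> = lan_leg N q x \<odot> \<phi> x"
      by (simp add: lan_leg_amap[OF N xy yq])
    finally show ?thesis .
  qed
  moreover have "lan_leg N q p \<odot> \<phi> p \<in> hom C (omap M p) (omap (lan N) q)"
    if "p \<in> Field P" "(f p, q) \<in> Q" for p
    using \<phi> that by (intro Cmp_hom[OF _ lan_leg_hom[OF N that]]) (simp add: pmod_hom_iff)
  ultimately have "cocone (slice P Q f q) C M (omap (lan N) q) (\<lambda>p. lan_leg N q p \<odot> \<phi> p)"
    by (simp add: cocone_slice_iff lan_Obj[OF N])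
  note * = desc_slice[OF M this]
  show "push_nt P Q f C M N \<phi> q \<in> hom C (omap (lan M) q) (omap (lan N) q)"
    using *(1) eq by simp
  show "push_nt P Q f C M N \<phi> q \<odot> lan_leg M q p = lan_leg N q p \<odot> \<phi> p"
    if "p \<in> Field P" "(f p, q) \<in> Q" for p
    using *(2) eq that by simp
qed

text \<open>
  The transpose as counit after \<open>f\<^sub>* \<phi>\<close>. The relative \<open>\<Sigma>\<close> contains the counit so that composites
  of relative shifts can be formed; composed with a shifted \<open>\<psi>\<close> it turns \<open>\<psi>\<close> into its transpose.
\<close>

lemma counit_push_nt:
  assumes M: "is_pmod P C M" and K: "is_pmod Q C K" and \<phi>: "pmod_hom P C M (pull f K) \<phi>"
    and q: "q \<in> Field Q"
  shows "adj_counit P Q f C K q \<odot> push_nt P Q f C M (pull f K) \<phi> q = flat M K \<phi> q"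
proof -
  note fK = is_pmod_pull[OF f K]
  note c = adj_counit_hom[OF K q] and n = push_nt_hom[OF M fK \<phi>]
  show ?thesis
  proof (rule lan_arrow_eqI[OF M Cmp_hom[OF n c] flat_hom[OF assms]])
    fix p assume p: "p \<in> Field P" and pq: "(f p, q) \<in> Q"
    have h: "\<phi> p \<in> hom C (omap M p) (omap (pull f K) p)"
      using \<phi> p by (simp add: pmod_hom_iff)
    show "(adj_counit P Q f C K q \<odot> push_nt P Q f C M (pull f K) \<phi> q) \<odot> lan_leg M q p
        = flat M K \<phi> q \<odot> lan_leg M q p"
      using Cmp_assoc[OF lan_leg_hom[OF M p pq] n c] Cmp_assoc[OF h lan_leg_hom[OF fK p pq] c]
      by (simp add: push_nt_leg[OF M fK \<phi> p pq] adj_counit_leg[OF K q p pq]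
          flat_leg[OF assms p pq])
  qed
qed

end


section \<open>Interleavings and the isometry\<close>

locale pushforward_translations = pushforward P Q f C
  for P :: "'p rel" and Q :: "'q rel" and f :: "'p \<Rightarrow> 'q" and C :: "('o, 'a) cat" (structure) +
  fixes T :: "real \<Rightarrow> 'q \<Rightarrow> 'q"
  assumes T: "superlinear_family Q T"
begin

lemma T_map: "0 \<le> \<epsilon> \<Longrightarrow> poset_map Q Q (T \<epsilon>)"
  using T by (simp add: superlinear_family_def translation_def)

lemma T_ge: "0 \<le> \<epsilon> \<Longrightarrow> q \<in> Field Q \<Longrightarrow> (q, T \<epsilon> q) \<in> Q"
  using T by (simp add: superlinear_family_def translation_def)

lemma T_add: "0 \<le> \<epsilon> \<Longrightarrow> 0 \<le> \<delta> \<Longrightarrow> q \<in> Field Q \<Longrightarrow> (T \<delta> (T \<epsilon> q), T (\<epsilon> + \<delta>) q) \<in> Q"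
  using T by (simp add: superlinear_family_def)

lemma T_0_le: "0 \<le> \<epsilon> \<Longrightarrow> q \<in> Field Q \<Longrightarrow> (T 0 q, T \<epsilon> q) \<in> Q"
  using T_ge[of \<epsilon> "T 0 q"] T_add[of 0 \<epsilon> q] poset_mapD(2)[OF T_map[of 0]] Q_trans by simp

lemma ident_map: "poset_map Q Q (\<lambda>q. q)"
  using Q by (simp add: poset_map_def compat_def)

text \<open>
  Injectivity of transposition applies to natural maps only, so both sides of the interleaving
  equation over \<open>Q\<close> have to be recognized as morphisms of modules.
\<close>

lemma pmod_hom_roundtrip:
  assumes M: "is_pmod Q C M" and N: "is_pmod Q C N" and e: "0 \<le> \<epsilon>"
    and \<Phi>: "pmod_hom Q C M (shiftQ T \<epsilon> N) \<Phi>" and \<Psi>: "pmod_hom Q C N (shiftQ T \<epsilon> M) \<Psi>"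
  shows "pmod_hom Q C M (shiftQ T (2 * \<epsilon>) M)
    (vcomp C (SigmaQ T \<epsilon> \<epsilon> M) (vcomp C (shiftQ_nt T \<epsilon> \<Psi>) \<Phi>))"
proof -
  have TT: "poset_map Q Q (\<lambda>q. T \<epsilon> (T \<epsilon> q))"
    using T_map[OF e] Q by (auto simp: poset_map_def compat_def)
  have 2: "0 \<le> 2 * \<epsilon>"
    using e by simp
  have m: "is_pmod Q C (pull (T \<epsilon>) N)" "is_pmod Q C (pull (\<lambda>q. T \<epsilon> (T \<epsilon> q)) M)"
      "is_pmod Q C (pull (T (2 * \<epsilon>)) M)"
    by (rule is_pmod_pull[OF T_map[OF e] N] is_pmod_pull[OF TT M] is_pmod_pull[OF T_map[OF 2] M])+
  have "(T \<epsilon> (T \<epsilon> q), T (2 * \<epsilon>) q) \<in> Q" if "q \<in> Field Q" for q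
    using T_add[OF e e that] by (simp only: mult_2)
  from pmod_hom_internal[OF TT T_map[OF 2] this M]
  have S: "pmod_hom Q C (pull (\<lambda>q. T \<epsilon> (T \<epsilon> q)) M) (pull (T (2 * \<epsilon>)) M) (SigmaQ T \<epsilon> \<epsilon> M)"
    by (simp only: SigmaQ_def[abs_def] mult_2)
  have \<Psi>': "pmod_hom Q C (pull (T \<epsilon>) N) (pull (\<lambda>q. T \<epsilon> (T \<epsilon> q)) M) (shiftQ_nt T \<epsilon> \<Psi>)"
    using pmod_hom_pull[OF T_map[OF e] \<Psi>] by (simp add: shiftQ_nt_def shiftQ_def)
  have \<Phi>': "pmod_hom Q C M (pull (T \<epsilon>) N) \<Phi>"
    using \<Phi> by (simp add: shiftQ_def)
  show ?thesis
    unfolding shiftQ_def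
    by (rule pmod_hom_vcomp[OF M m(2,3) pmod_hom_vcomp[OF M m(1,2) \<Phi>' \<Psi>'] S])
qed

lemma pmod_hom_eta:
  assumes M: "is_pmod Q C M" and e: "0 \<le> \<epsilon>"
  shows "pmod_hom Q C M (shiftQ T \<epsilon> M) (vcomp C (etaQ2 T 0 \<epsilon> M) (etaQ T 0 M))"
proof -
  note m = is_pmod_pull[OF T_map M]
  have "pmod_hom Q C M (pull (T 0) M) (etaQ T 0 M)"
    using pmod_hom_internal[OF ident_map T_map[OF order_refl] T_ge[OF order_refl] M]
    by (simp add: etaQ_def[abs_def])
  moreover have "pmod_hom Q C (pull (T 0) M) (pull (T \<epsilon>) M) (etaQ2 T 0 \<epsilon> M)"
    using pmod_hom_internal[OF T_map[OF order_refl] T_map[OF e] T_0_le[OF e] M]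
    by (simp add: etaQ2_def[abs_def])
  ultimately show ?thesis
    unfolding shiftQ_def by (rule pmod_hom_vcomp[OF M m[OF order_refl] m[OF e]])
qed

text \<open>
  Both sides of the relative equation are transposes of the two sides over \<open>Q\<close>; as transposition
  is injective, the equations are equivalent. The morphisms \<open>\<phi>\<close> and \<open>\<psi>\<close> are tied to \<open>\<Phi>\<close> and \<open>\<Psi>\<close> on
  the carrier of \<open>P\<close> only, so that the lemma serves with either pair as the given one.
\<close>

lemma roundtrip_iff:
  assumes M: "is_pmod P C M" and N: "is_pmod P C N" and e: "0 \<le> \<epsilon>"
    and \<Phi>: "pmod_hom Q C (lan M) (shiftQ T \<epsilon> (lan N)) \<Phi>"
    and \<Psi>: "pmod_hom Q C (lan N) (shiftQ T \<epsilon> (lan M)) \<Psi>"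
    and \<phi>: "\<And>p. p \<in> Field P \<Longrightarrow> \<phi> p = sharp M \<Phi> p"
    and \<psi>: "pmod_hom P C N (shiftP P Q f T C \<epsilon> M) \<psi>" "\<And>p. p \<in> Field P \<Longrightarrow> \<psi> p = sharp N \<Psi> p"
  shows "(\<forall>p \<in> Field P.
        vcomp C (SigmaP P Q f T C \<epsilon> \<epsilon> M)
          (vcomp C (shiftP_nt P Q f T C \<epsilon> N (shiftP P Q f T C \<epsilon> M) \<psi>) \<phi>) p =
        vcomp C (etaP2 P Q f T C 0 (2 * \<epsilon>) M) (etaP P Q f T C 0 M) p) \<longleftrightarrow>
     (\<forall>q \<in> Field Q.
        vcomp C (SigmaQ T \<epsilon> \<epsilon> (lan M)) (vcomp C (shiftQ_nt T \<epsilon> \<Psi>) \<Phi>) q =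
        vcomp C (etaQ2 T 0 (2 * \<epsilon>) (lan M)) (etaQ T 0 (lan M)) q)"
proof -
  note lM = is_pmod_lan[OF M] and lN = is_pmod_lan[OF N]
  let ?K = "shiftQ T \<epsilon> (lan M)"
  let ?L = "vcomp C (SigmaQ T \<epsilon> \<epsilon> (lan M)) (vcomp C (shiftQ_nt T \<epsilon> \<Psi>) \<Phi>)"
  let ?R = "vcomp C (etaQ2 T 0 (2 * \<epsilon>) (lan M)) (etaQ T 0 (lan M))"
  have K: "is_pmod Q C ?K"
    unfolding shiftQ_def by (rule is_pmod_pull[OF T_map[OF e] lM])
  have 2: "0 \<le> 2 * \<epsilon>"
    using e by simp
  have K2: "is_pmod Q C (shiftQ T (2 * \<epsilon>) (lan M))"
    unfolding shiftQ_def by (rule is_pmod_pull[OF T_map[OF 2] lM])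
  have \<psi>': "pmod_hom P C N (pull f ?K) \<psi>"
    using \<psi>(1) by (simp add: shiftP_def)
  have L: "vcomp C (SigmaP P Q f T C \<epsilon> \<epsilon> M)
      (vcomp C (shiftP_nt P Q f T C \<epsilon> N (shiftP P Q f T C \<epsilon> M) \<psi>) \<phi>) p = sharp M ?L p"
    if p: "p \<in> Field P" for p
  proof -
    let ?q = "T \<epsilon> (f p)"
    let ?S = "amap (lan M) (T \<epsilon> ?q, T (\<epsilon> + \<epsilon>) (f p))"
    have fp: "f p \<in> Field Q" and q: "?q \<in> Field Q"
      using p f_mono(2) poset_mapD(2)[OF T_map[OF e]] by auto
    note fpp = Q_refl[OF fp]
    note c = adj_counit_hom[OF K q] and n = push_nt_hom[OF N is_pmod_pull[OF f K] \<psi>', of ?q]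
    note i = lan_leg_hom[OF M p fpp]
    have S: "?S \<in> hom C (omap ?K ?q) (omap (lan M) (T (\<epsilon> + \<epsilon>) (f p)))"
      using lan_amap_hom[OF M T_add[OF e e fp]] by (simp add: shiftQ_def)
    have F: "\<Phi> (f p) \<in> hom C (omap (lan M) (f p)) (omap (lan N) ?q)"
      using \<Phi> fp by (simp add: pmod_hom_iff shiftQ_def)
    have G: "\<Psi> ?q \<in> hom C (omap (lan N) ?q) (omap ?K ?q)"
      using \<Psi> q by (simp add: pmod_hom_iff)
    note sh = Cmp_hom[OF i F]
    \<comment> \<open>Reassociate until the counit stands next to \<open>f\<^sub>* \<psi>\<close>, where the two merge into \<open>\<Psi>\<close>.\<close>
    have "(?S \<odot> adj_counit P Q f C ?K ?q) \<odot> (push_nt P Q f C N (pull f ?K) \<psi> ?q \<odot> sharp M \<Phi> p)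
        = ?S \<odot> ((adj_counit P Q f C ?K ?q \<odot> push_nt P Q f C N (pull f ?K) \<psi> ?q) \<odot> sharp M \<Phi> p)"
      using Cmp_assoc[OF Cmp_hom[OF sh n] c S] Cmp_assoc[OF sh n c] by (simp add: sharp_def)
    also have "adj_counit P Q f C ?K ?q \<odot> push_nt P Q f C N (pull f ?K) \<psi> ?q = \<Psi> ?q"
      using counit_push_nt[OF N K \<psi>' q] flat_sharp[OF N K \<Psi> \<psi>' \<psi>(2) q] by simp
    also have "?S \<odot> (\<Psi> ?q \<odot> sharp M \<Phi> p) = sharp M ?L p"
      using Cmp_assoc[OF i F G] Cmp_assoc[OF i Cmp_hom[OF F G] S]
      by (simp add: sharp_def vcomp_def SigmaQ_def shiftQ_nt_def pull_nt_def)
    finally show ?thesis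
      by (simp add: vcomp_def SigmaP_def shiftP_nt_def shiftP_def pull_nt_def shiftQ_nt_def
          SigmaQ_def \<phi>[OF p])
  qed
  have R: "vcomp C (etaP2 P Q f T C 0 (2 * \<epsilon>) M) (etaP P Q f T C 0 M) p = sharp M ?R p"
    if p: "p \<in> Field P" for p
  proof -
    have fp: "f p \<in> Field Q"
      by (rule f_mono(2)[OF p])
    show ?thesis
      using Cmp_assoc[OF lan_leg_hom[OF M p Q_refl[OF fp]] lan_amap_hom[OF M T_ge[OF order_refl fp]]
          lan_amap_hom[OF M T_0_le[OF 2 fp]]]
      by (simp add: vcomp_def etaP2_def etaP_def pull_nt_def etaQ2_def etaQ_def adj_unit_def
          sharp_def)
  qed
  show ?thesis
    using sharp_eq_iff[OF M K2 pmod_hom_roundtrip[OF lM lN e \<Phi> \<Psi>] pmod_hom_eta[OF lM 2]]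
    by (simp add: L R)
qed

lemma weak_interleaving_iff:
  assumes M: "is_pmod P C M" and N: "is_pmod P C N" and e: "0 \<le> \<epsilon>"
    and \<Phi>: "pmod_hom Q C (lan M) (shiftQ T \<epsilon> (lan N)) \<Phi>"
    and \<Psi>: "pmod_hom Q C (lan N) (shiftQ T \<epsilon> (lan M)) \<Psi>"
    and \<phi>: "pmod_hom P C M (shiftP P Q f T C \<epsilon> N) \<phi>" "\<And>p. p \<in> Field P \<Longrightarrow> \<phi> p = sharp M \<Phi> p"
    and \<psi>: "pmod_hom P C N (shiftP P Q f T C \<epsilon> M) \<psi>" "\<And>p. p \<in> Field P \<Longrightarrow> \<psi> p = sharp N \<Psi> p"
  shows "weak_interleavingP P Q f T C \<epsilon> M N \<phi> \<psi> \<longleftrightarrow>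
    weak_interleavingQ Q T C \<epsilon> (lan M) (lan N) \<Phi> \<Psi>"
  unfolding weak_interleavingP_def weak_interleavingQ_def
  by (intro conj_cong roundtrip_iff) (simp_all add: assms)

lemma ex_weak_interleaving_iff:
  assumes M: "is_pmod P C M" and N: "is_pmod P C N" and e: "0 \<le> \<epsilon>"
  shows "(\<exists>\<phi> \<psi>. weak_interleavingP P Q f T C \<epsilon> M N \<phi> \<psi>) \<longleftrightarrow>
    (\<exists>\<Phi> \<Psi>. weak_interleavingQ Q T C \<epsilon> (lan M) (lan N) \<Phi> \<Psi>)"
proof -
  have K: "is_pmod Q C (shiftQ T \<epsilon> (lan M))" "is_pmod Q C (shiftQ T \<epsilon> (lan N))"
    unfolding shiftQ_def by (rule is_pmod_pull[OF T_map[OF e]] is_pmod_lan M N)+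
  show ?thesis
  proof (intro iffI; elim exE)
    fix \<phi> \<psi> assume w: "weak_interleavingP P Q f T C \<epsilon> M N \<phi> \<psi>"
    then have \<phi>: "pmod_hom P C M (shiftP P Q f T C \<epsilon> N) \<phi>"
      and \<psi>: "pmod_hom P C N (shiftP P Q f T C \<epsilon> M) \<psi>"
      by (simp_all add: weak_interleavingP_def)
    note \<phi>' = \<phi>[unfolded shiftP_def] and \<psi>' = \<psi>[unfolded shiftP_def]
    show "\<exists>\<Phi> \<Psi>. weak_interleavingQ Q T C \<epsilon> (lan M) (lan N) \<Phi> \<Psi>"
      using w weak_interleaving_iff[OF M N e pmod_hom_flat[OF M K(2) \<phi>']
          pmod_hom_flat[OF N K(1) \<psi>'] \<phi> sharp_flat[OF M K(2) \<phi>', symmetric]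
          \<psi> sharp_flat[OF N K(1) \<psi>', symmetric]]
      by blast
  next
    fix \<Phi> \<Psi> assume w: "weak_interleavingQ Q T C \<epsilon> (lan M) (lan N) \<Phi> \<Psi>"
    then have \<Phi>: "pmod_hom Q C (lan M) (shiftQ T \<epsilon> (lan N)) \<Phi>"
      and \<Psi>: "pmod_hom Q C (lan N) (shiftQ T \<epsilon> (lan M)) \<Psi>"
      by (simp_all add: weak_interleavingQ_def)
    note \<phi> = pmod_hom_sharp[OF M K(2) \<Phi>, folded shiftP_def]
      and \<psi> = pmod_hom_sharp[OF N K(1) \<Psi>, folded shiftP_def]
    show "\<exists>\<phi> \<psi>. weak_interleavingP P Q f T C \<epsilon> M N \<phi> \<psi>"
      using w weak_interleaving_iff[OF M N e \<Phi> \<Psi> \<phi> refl \<psi> refl] by blast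
  qed
qed

end

theorem theorem4p17:
  fixes P :: "'p rel" and Q :: "'q rel" and f :: "'p \<Rightarrow> 'q"
    and T :: "real \<Rightarrow> 'q \<Rightarrow> 'q" and C :: "('o, 'a) cat"
    and M N :: "('p, 'o, 'a) pmod"
  assumes "Partial_order P" and "Partial_order Q"
    and "superlinear_family Q T"
    and "poset_map P Q f"
    and "cocomplete TYPE('p) TYPE('p \<times> 'p) C"
    and "is_pmod P C M" and "is_pmod P C N"
  shows "distP P Q f T C M N = distQ Q T C (push P Q f C M) (push P Q f C N)"
proof -
  interpret pushforward_translations P Q f C T
    using assms by unfold_locales
  have "{\<epsilon>. 0 \<le> \<epsilon> \<and> (\<exists>\<phi> \<psi>. weak_interleavingP P Q f T C \<epsilon> M N \<phi> \<psi>)} =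
      {\<epsilon>. 0 \<le> \<epsilon> \<and> (\<exists>\<Phi> \<Psi>. weak_interleavingQ Q T C \<epsilon> (lan M) (lan N) \<Phi> \<Psi>)}"
    using ex_weak_interleaving_iff[OF assms(6,7)] by blast
  then show ?thesis
    by (simp add: distP_def distQ_def)
qed

end
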